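(* Let $(X,E)$ be a strict poset, let $\mathscr{R}$ be an equivalence relation on $X$, and let $S$ be the relation on $X/\mathscr{R}$ induced by $E$, that is, the transitive closure of the relation $S_0$ on $X/\mathscr{R}$ defined by $$([a],[b])\in S_0 \iff \exists x,y\in X:\ a\sim x,\ b\sim y,\ (x,y)\in E.$$ Then the following statements are equivalent: 1. $S$ is a strict partial order on $X/\mathscr{R}$; 2. there are no cycles in $S_0$; 3. the quotient map $q_{\mathscr{R}}:(X,E)\to(X/\mathscr{R},S)$ is order preserving.
   Context: A strict partial order on a set is an irreflexive and transitive relation; a strict poset is a pair consisting of a set and a strict partial order on it. For an equivalence relation $\mathscr{R}$ on $X$, $x\sim y$ means $(x,y)\in\mathscr{R}$, $[x]$ is the equivalence class of $x$, $X/\mathscr{R}$ is the set of equivalence classes, and $q_{\mathscr{R}}:X\to X/\mathscr{R}$ is the map $q_{\mathscr{R}}(x)=[x]$. A cycle in a relation $R$ is a sequence of pairs in $R$ of the form $(a,b_1),(b_1,b_2),\ldots,(b_n,a)$. The transitive closure of a relation $R$ is the minimal set $\overline{R}$ such that whenever there is a sequence of pairs $(a_1,a_2),(a_2,a_3),\ldots,(a_{n-1},a_n)$ in $R$, then $(a_1,a_n)\in\overline{R}$. A map $f:(X,<_X)\to(Y,<_Y)$ is order preserving if $a<_X b \Rightarrow f(a)<_Y f(b)$.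
   Formalization: Statement 3 is read as: S is a strict partial order on the quotient and q preserves order; with only the implication a<b ⇒ q(a)<q(b), statement 3 always holds and the equivalence fails (X={a<b}, a∼b). *)

theory Defs
  imports Main
begin

definition strict_poset :: "'a set \<Rightarrow> 'a rel \<Rightarrow> bool" where
  "strict_poset X E \<longleftrightarrow> E \<subseteq> X \<times> X \<and> irrefl_on X E \<and> trans_on X E"

(* Order preserving maps are maps between strict posets, so being one includes that domain
   and codomain are strict posets.  This matters when the relation on the codomain is not
   known in advance to be a strict partial order, as for an induced relation on a quotient:
   there the bare implication "a < b implies f a < f b" would hold trivially. *)
definition order_preserving ::
    "'a set \<Rightarrow> 'a rel \<Rightarrow> 'b set \<Rightarrow> 'b rel \<Rightarrow> ('a \<Rightarrow> 'b) \<Rightarrow> bool" where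
  "order_preserving X E Y F f \<longleftrightarrow>
     strict_poset X E \<and> strict_poset Y F \<and> f ` X \<subseteq> Y \<and>
     monotone_on X (\<lambda>a b. (a, b) \<in> E) (\<lambda>a b. (a, b) \<in> F) f"

(* The zip is the list (a,b1), (b1,b2), ..., (bn,a).  For bs = [] it is the loop (a,a). *)
definition cycle_in :: "'a rel \<Rightarrow> ('a \<times> 'a) list \<Rightarrow> bool" where
  "cycle_in R ps \<longleftrightarrow> set ps \<subseteq> R \<and> (\<exists>a bs. ps = zip (a # bs) (bs @ [a]))"

definition quotient_map :: "'a rel \<Rightarrow> 'a \<Rightarrow> 'a set" where
  "quotient_map R x = R `` {x}"

definition quotient_rel0 :: "'a set \<Rightarrow> 'a rel \<Rightarrow> 'a rel \<Rightarrow> 'a set rel" where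
  "quotient_rel0 X E R =
     {(R `` {a}, R `` {b}) | a b. a \<in> X \<and> b \<in> X \<and>
        (\<exists>x\<in>X. \<exists>y\<in>X. (a, x) \<in> R \<and> (b, y) \<in> R \<and> (x, y) \<in> E)}"

definition quotient_rel :: "'a set \<Rightarrow> 'a rel \<Rightarrow> 'a rel \<Rightarrow> 'a set rel" where
  "quotient_rel X E R = (quotient_rel0 X E R)\<^sup>+"

end

theory Submission
  imports Defs
begin

text \<open>The induced relation is a transitive closure, and it stays inside the set of classes, so
  it is a strict partial order exactly when no class is related to itself. By
  \<open>trancl_iff_zip_subset\<close> such a self-relation is the same thing as a cycle of
  \<open>quotient_rel0\<close>; this gives the first equivalence. For the second, the quotient map
  always sends \<open>E\<close>-pairs to related classes
  (\<open>quotient_map_quotient_rel0\<close>), so being order preserving comes down to the codomain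
  being a strict poset.\<close>

text \<open>The list has the shape used in \<open>cycle_in\<close>, but its endpoint
  \<open>c\<close> is kept apart from \<open>a\<close>: peeling off the first pair moves the start
  and not the end, so closed chains alone would not support an induction. Cycles are the case
  \<open>c = a\<close>.\<close>

lemma trancl_iff_zip_subset:
  "(a, c) \<in> R\<^sup>+ \<longleftrightarrow> (\<exists>bs. set (zip (a # bs) (bs @ [c])) \<subseteq> R)"
proof
  assume "(a, c) \<in> R\<^sup>+"
  then show "\<exists>bs. set (zip (a # bs) (bs @ [c])) \<subseteq> R"
  proof (induction rule: converse_trancl_induct)
    case (base a)
    then have "set (zip (a # []) ([] @ [c])) \<subseteq> R" by simp
    then show ?case by blast
  next
    case (step a b)
    then obtain bs where "set (zip (b # bs) (bs @ [c])) \<subseteq> R" by blast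
    with step.hyps have "set (zip (a # b # bs) ((b # bs) @ [c])) \<subseteq> R" by simp
    then show ?case by blast
  qed
next
  assume "\<exists>bs. set (zip (a # bs) (bs @ [c])) \<subseteq> R"
  then obtain bs where "set (zip (a # bs) (bs @ [c])) \<subseteq> R" by blast
  then show "(a, c) \<in> R\<^sup>+"
  proof (induction bs arbitrary: a)
    case Nil
    then show ?case by auto
  next
    case (Cons b bs)
    then have "(a, b) \<in> R" "(b, c) \<in> R\<^sup>+" by simp_all
    then show ?case by (rule trancl_into_trancl2)
  qed
qed

lemma acyclic_iff_no_cycle: "acyclic R \<longleftrightarrow> \<not> (\<exists>ps. cycle_in R ps)"
  unfolding acyclic_def cycle_in_def trancl_iff_zip_subset by blast

text \<open>Only irreflexivity is at stake. \<open>acyclic\<close> speaks of all points of the type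
  and \<open>irrefl_on\<close> only of those in \<open>Y\<close>; they agree because a loop of the
  closure lies in \<open>Y \<times> Y\<close>.\<close>

lemma strict_poset_trancl_iff_acyclic:
  assumes "S \<subseteq> Y \<times> Y"
  shows "strict_poset Y (S\<^sup>+) \<longleftrightarrow> acyclic S"
proof -
  have "S\<^sup>+ \<subseteq> Y \<times> Y" using assms by (rule trancl_subset_Sigma)
  moreover have "trans_on Y (S\<^sup>+)" by (auto intro: trans_onI)
  ultimately show ?thesis
    unfolding strict_poset_def acyclic_def irrefl_on_def by blast
qed

lemma quotient_rel0_subset: "quotient_rel0 X E R \<subseteq> (X // R) \<times> (X // R)"
  unfolding quotient_rel0_def by (auto intro: quotientI)

lemma quotient_map_quotient_rel0:
  assumes "equiv X R" "a \<in> X" "b \<in> X" "(a, b) \<in> E"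
  shows "(quotient_map R a, quotient_map R b) \<in> quotient_rel0 X E R"
  using assms unfolding quotient_rel0_def quotient_map_def
  \<comment> \<open>The rewritten rule is reflexivity of \<open>R\<close> on \<open>X\<close>; it
    lets \<open>a\<close> and \<open>b\<close> themselves serve as the representatives
    \<open>x\<close> and \<open>y\<close>.\<close>
  by (blast intro: equiv_class_self[unfolded Image_singleton_iff])

theorem theorem13:
  fixes X :: "'a set" and E R :: "'a rel"
  assumes "strict_poset X E"
    and "equiv X R"
  shows "(strict_poset (X // R) (quotient_rel X E R) \<longleftrightarrow>
            \<not> (\<exists>ps. cycle_in (quotient_rel0 X E R) ps)) \<and>
         (\<not> (\<exists>ps. cycle_in (quotient_rel0 X E R) ps) \<longleftrightarrow>
            order_preserving X E (X // R) (quotient_rel X E R) (quotient_map R))"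
proof -
  have "strict_poset (X // R) (quotient_rel X E R) \<longleftrightarrow>
      \<not> (\<exists>ps. cycle_in (quotient_rel0 X E R) ps)"
    unfolding quotient_rel_def
    using strict_poset_trancl_iff_acyclic[OF quotient_rel0_subset]
    by (simp add: acyclic_iff_no_cycle)
  moreover have "quotient_map R ` X \<subseteq> X // R"
    by (auto simp: quotient_map_def intro: quotientI)
  \<comment> \<open>This holds even when cycles exist, since a relation is contained in its
    transitive closure.\<close>
  moreover have "monotone_on X (\<lambda>a b. (a, b) \<in> E) (\<lambda>a b. (a, b) \<in> quotient_rel X E R)
      (quotient_map R)"
    using quotient_map_quotient_rel0[OF assms(2)]
    unfolding quotient_rel_def by (blast intro: monotone_onI)
  ultimately show ?thesis
    using assms(1) unfolding order_preserving_def by blast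
qed

end
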